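(* For $x>e$ define $$\beta_0(x)=\ln(x)-\ln(\ln(x)),\qquad \beta_{n+1}(x)=\frac{\beta_n(x)}{1+\beta_n(x)}\left(1+\ln\left(\frac{x}{\beta_n(x)}\right)\right)\quad(n\in\mathbb{N}),$$ and let $\kappa_1=\ln(1+1/e)$. Then for every integer $n\ge1$ and every $x>e$, $$0<\mathrm{W}_0(x)-\beta_n(x)<\frac{\left(\frac{e}{e-1}\,\frac{\ln(\ln(x))}{\ln(x)}\right)^{2^n}}{\left(\ln(x)-\ln(\ln(x))\right)^{-1+2^n}},$$ and also the uniform estimate $$0<\mathrm{W}_0(x)-\beta_n(x)<\kappa_1^{2^n}<\left(\frac{32}{100}\right)^{2^n}$$ holds.
   Context: $\mathbb{N}=\{0,1,2,\ldots\}$. $\mathrm{W}_0:[-1/e,\infty)\to[-1,\infty)$ is the principal real branch of the Lambert function: $\mathrm{W}_0(x)$ is the unique $w\ge -1$ with $we^w=x$. *)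

theory Defs
  imports "HOL-Analysis.Analysis"
begin

text \<open>
  The principal real branch of the Lambert function. The definition determines a value only for
  \<open>x \<ge> - 1 / exp 1\<close> (lemma \<open>Lambert_W0_ex1\<close>); elsewhere it is unspecified.
\<close>
definition Lambert_W0 :: "real \<Rightarrow> real" where
  "Lambert_W0 x = (THE w. w \<ge> - 1 \<and> w * exp w = x)"

lemma times_exp_less:
  fixes u v :: real
  assumes "- 1 \<le> u" "u < v"
  shows "u * exp u < v * exp v"
proof (rule DERIV_pos_imp_increasing_open [OF assms(2)])
  fix t :: real
  assume t: "u < t" "t < v"
  have "((\<lambda>w. w * exp w) has_real_derivative (1 + t) * exp t) (at t)"
    by (auto intro!: derivative_eq_intros simp: algebra_simps)
  moreover have "(1 + t) * exp t > 0"
    using t assms by simp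
  ultimately show "\<exists>y. ((\<lambda>w. w * exp w) has_real_derivative y) (at t) \<and> y > 0"
    by blast
qed (auto intro!: continuous_intros)

lemma Lambert_W0_ex1:
  fixes x :: real
  assumes "x \<ge> - 1 / exp 1"
  shows "\<exists>!w. w \<ge> - 1 \<and> w * exp w = x"
proof (rule ex_ex1I)
  have "\<bar>x\<bar> * 1 \<le> \<bar>x\<bar> * exp \<bar>x\<bar>"
    by (intro mult_left_mono) auto
  hence "x \<le> \<bar>x\<bar> * exp \<bar>x\<bar>"
    by linarith
  moreover have "(- 1) * exp (- 1) \<le> x"
    using assms by (simp add: exp_minus field_simps)
  moreover have "continuous_on {- 1..\<bar>x\<bar>} (\<lambda>w::real. w * exp w)"
    by (intro continuous_intros)
  moreover have "- 1 \<le> \<bar>x\<bar>"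
    by linarith
  ultimately show "\<exists>w. w \<ge> - 1 \<and> w * exp w = x"
    using IVT'[of "\<lambda>w. w * exp w" "- 1" x "\<bar>x\<bar>"] by blast
next
  fix u v :: real
  assume "u \<ge> - 1 \<and> u * exp u = x" "v \<ge> - 1 \<and> v * exp v = x"
  thus "u = v"
    using times_exp_less[of u v] times_exp_less[of v u]
    by (cases u v rule: linorder_cases) auto
qed

lemma Lambert_W0:
  assumes "x \<ge> - 1 / exp 1"
  shows "Lambert_W0 x \<ge> - 1" "Lambert_W0 x * exp (Lambert_W0 x) = x"
  using theI'[OF Lambert_W0_ex1[OF assms]] by (auto simp: Lambert_W0_def)

primrec beta :: "nat \<Rightarrow> real \<Rightarrow> real" where
  "beta 0 x = ln x - ln (ln x)"
| "beta (Suc n) x = beta n x / (1 + beta n x) * (1 + ln (x / beta n x))"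

definition kappa1 :: real where
  "kappa1 = ln (1 + 1 / exp 1)"

end

theory Submission
  imports Defs
begin

text \<open>
  Write \<open>w\<close> for the Lambert value of \<open>x\<close>, so that \<open>w + ln w = ln x\<close>. The recursion is Newton's
  method for this equation, and with \<open>d = (w - b) / b\<close> one step from \<open>b\<close> has the error
  \<open>b / (1 + b) * (d - ln (1 + d))\<close>. This lies strictly between \<open>0\<close> and \<open>b * d\<^sup>2 / (1 + b)\<close>, so the
  iterates increase, stay below \<open>w\<close>, and their errors are squared (and divided by \<open>beta 0 x > 1\<close>)
  in each step. The initial error is \<open>ln (1 + ln w / w)\<close>, and \<open>ln w / w \<le> 1 / e\<close>.
\<close>

text \<open>By concavity \<open>ln\<close> lies below its tangent at \<open>exp 1\<close>, and that
  tangent passes through the origin.\<close>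

lemma ln_le_div_exp_1:
  fixes w :: real
  assumes "w > 0"
  shows "ln w \<le> w / exp 1"
proof -
  have "ln (w / exp 1) \<le> w / exp 1 - 1"
    using assms by (intro ln_le_minus_one) simp
  thus ?thesis
    using assms by (simp add: ln_div)
qed

text \<open>The bound \<open>1 - 1 / t \<le> ln t\<close> at \<open>t = 1 + d\<close> gives
  \<open>d / (1 + d)\<close>, which exceeds \<open>d - d\<^sup>2\<close> by
  \<open>d ^ 3 / (1 + d)\<close>.\<close>

lemma ln_1_plus_ge:
  fixes d :: real
  assumes "d \<ge> 0"
  shows "d - d\<^sup>2 \<le> ln (1 + d)"
proof -
  have "ln (1 / (1 + d)) \<le> 1 / (1 + d) - 1"
    using assms by (intro ln_le_minus_one) simp
  moreover have "ln (1 / (1 + d)) = - ln (1 + d)"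
    using assms by (simp add: ln_div)
  moreover have "1 / (1 + d) - 1 \<le> d\<^sup>2 - d"
  proof -
    have "d\<^sup>2 - d - (1 / (1 + d) - 1) = d ^ 3 / (1 + d)"
      using assms by (simp add: field_simps power2_eq_square power3_eq_cube)
    moreover have "d ^ 3 / (1 + d) \<ge> 0"
      using assms by simp
    ultimately show ?thesis
      by linarith
  qed
  ultimately show ?thesis
    by linarith
qed

lemma kappa1_pos: "0 < kappa1"
  unfolding kappa1_def by (intro ln_gt_zero) simp

lemma kappa1_less: "kappa1 < 32 / 100"
proof -
  \<comment> \<open>The comparison below needs e > 1 / 0.3712, about 2.694. The quadratic Taylor
    bound at 1 yields only 5/2; taken at 1/8 and raised to the eighth power it yields more than
    27/10.\<close>
  have "(1 + 1 / 8 + (1 / 8)\<^sup>2 / 2) ^ 8 \<le> exp (1 / 8 :: real) ^ 8"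
    by (intro power_mono exp_lower_Taylor_quadratic) auto
  also have "exp (1 / 8 :: real) ^ 8 = exp 1"
    by (simp flip: exp_of_nat_mult)
  finally have "27 / 10 < exp (1::real)"
    by (simp add: power_divide power2_eq_square)
  hence "1 + 1 / exp 1 < (1 + 32 / 100 + (32 / 100)\<^sup>2 / 2 :: real)"
    by (simp add: field_simps power2_eq_square)
  also have "\<dots> \<le> exp (32 / 100)"
    by (intro exp_lower_Taylor_quadratic) auto
  finally have "ln (1 + 1 / exp 1) < ln (exp (32 / 100 :: real))"
    by (subst ln_less_cancel_iff) (auto intro: add_pos_pos)
  thus ?thesis
    by (simp add: kappa1_def)
qed

lemma Lambert_W0_gt_1:
  assumes "x > exp 1"
  shows "Lambert_W0 x > 1" "Lambert_W0 x + ln (Lambert_W0 x) = ln x"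
proof -
  have "- 1 / exp 1 \<le> (0::real)"
    by simp
  hence x: "x \<ge> - 1 / exp 1"
    using assms exp_gt_zero[of "1::real"] by linarith
  note W = Lambert_W0[OF x]
  show "Lambert_W0 x > 1"
  proof (rule ccontr)
    assume "\<not> Lambert_W0 x > 1"
    hence "Lambert_W0 x * exp (Lambert_W0 x) \<le> 1 * exp 1"
      using times_exp_less[of "Lambert_W0 x" 1] W(1) by (cases "Lambert_W0 x = 1") auto
    thus False
      using W(2) assms by simp
  qed
  thus "Lambert_W0 x + ln (Lambert_W0 x) = ln x"
    by (subst (3) W(2)[symmetric]) (simp add: ln_mult)
qed

text \<open>Here \<open>b'\<close> is b - f(b) / f'(b) for f(t) = t + ln t - l. This f is increasing
  and concave, so a start below the root moves up without overshooting.\<close>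

lemma beta_step:
  fixes b w l :: real
  assumes "0 < b" "b < w" and l: "w + ln w = l"
  defines "b' \<equiv> b / (1 + b) * (1 + (l - ln b))"
  shows "b < b'" "b' < w" "w - b' \<le> (w - b)\<^sup>2 / (b * (1 + b))"
proof -
  define d where "d = (w - b) / b"
  have d: "d > 0" "1 + d = w / b" "w - b = b * d"
    using assms by (auto simp: d_def field_simps)
  have ln_d: "ln (1 + d) = ln w - ln b"
    using assms by (simp add: d ln_div)
  have err: "w - b' = b / (1 + b) * (d - ln (1 + d))"
    using assms(1) d(3) unfolding ln_d b'_def l[symmetric] by (simp add: field_simps)
  \<comment> \<open>The last factor is the residual \<open>l - (b + ln b)\<close>, written as a sum
    of two positive terms.\<close>
  have incr: "b' - b = b / (1 + b) * (b * d + ln (1 + d))"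
    using assms(1) d(3) unfolding ln_d b'_def l[symmetric] by (simp add: field_simps)
  have "b / (1 + b) * (b * d + ln (1 + d)) > 0"
    using assms(1) d(1) by (intro mult_pos_pos add_pos_pos) auto
  thus "b < b'"
    using incr by linarith
  have "b / (1 + b) * (d - ln (1 + d)) > 0"
    using assms(1) d(1) ln_add_one_self_less_self[of d] by (intro mult_pos_pos) auto
  thus "b' < w"
    using err by linarith
  have "b / (1 + b) * (d - ln (1 + d)) \<le> b / (1 + b) * d\<^sup>2"
    using assms(1) d(1) ln_1_plus_ge[of d] by (intro mult_left_mono) auto
  also have "\<dots> = (w - b)\<^sup>2 / (b * (1 + b))"
    using assms(1) unfolding d(3) by (simp add: power2_eq_square mult.assoc mult.left_commute)
  finally show "w - b' \<le> (w - b)\<^sup>2 / (b * (1 + b))"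
    using err by simp
qed

lemma beta_0_bounds:
  assumes x: "x > exp 1"
  shows "1 < beta 0 x" "beta 0 x < Lambert_W0 x"
    and "Lambert_W0 x - beta 0 x \<le> exp 1 / (exp 1 - 1) * (ln (ln x) / ln x)"
    and "Lambert_W0 x - beta 0 x \<le> kappa1"
proof -
  define w where "w = Lambert_W0 x"
  define l where "l = ln x"
  have w: "w > 1" "w + ln w = l"
    using Lambert_W0_gt_1[OF x] by (simp_all add: w_def l_def)
  have "ln w > 0"
    using w(1) by simp
  hence "l > w" "l > 1"
    using w by linarith+
  show "1 < beta 0 x"
    using ln_eq_minus_one[of l] ln_le_minus_one[of l] \<open>l > 1\<close>
    by (fastforce simp: l_def[symmetric])
  \<comment> \<open>Since \<open>w = l - ln w\<close> and \<open>beta 0 x = l - ln l\<close>, the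
    error is \<open>ln (l / w)\<close>.\<close>
  have err: "w - beta 0 x = ln (1 + ln w / w)"
  proof -
    have "1 + ln w / w = l / w"
      using w by (simp add: field_simps)
    thus ?thesis
      using w \<open>l > 1\<close> by (simp add: ln_div l_def[symmetric])
  qed
  have "ln (1 + ln w / w) > 0"
    using w(1) \<open>ln w > 0\<close> by (intro ln_gt_zero) simp
  thus "beta 0 x < Lambert_W0 x"
    using err unfolding w_def by linarith
  have "ln w / w \<le> 1 / exp 1"
    using ln_le_div_exp_1[of w] w(1) by (simp add: field_simps)
  hence "ln (1 + ln w / w) \<le> kappa1"
    unfolding kappa1_def using w(1) \<open>ln w > 0\<close> by (subst ln_le_cancel_iff) (auto simp: add_pos_pos)
  thus "Lambert_W0 x - beta 0 x \<le> kappa1"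
    using err by (simp add: w_def)
  have e: "exp 1 > (1::real)"
    by simp
  have ln_w: "ln w \<le> ln l"
    using \<open>l > w\<close> w(1) by simp
  \<comment> \<open>From \<open>w = l - ln w \<ge> l - ln l \<ge> l - l / exp 1\<close>: the factor
    1 - 1/e is the source of the constant e / (e - 1).\<close>
  hence "w \<ge> l - l / exp 1"
    using ln_le_div_exp_1[of l] w \<open>l > 1\<close> by linarith
  moreover have pos: "l - l / exp 1 > 0"
    using e \<open>l > 1\<close> by (simp add: field_simps)
  ultimately have "ln w / w \<le> ln l / (l - l / exp 1)"
    using ln_w \<open>l > 1\<close> by (intro frac_le) auto
  moreover have "ln (1 + ln w / w) \<le> ln w / w"
    using w(1) \<open>ln w > 0\<close> by (intro ln_add_one_self_le_self) simp
  moreover have "ln l / (l - l / exp 1) = exp 1 / (exp 1 - 1) * (ln l / l)"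
    using e \<open>l > 1\<close> by (simp add: divide_simps) (simp add: algebra_simps)
  ultimately show "Lambert_W0 x - beta 0 x \<le> exp 1 / (exp 1 - 1) * (ln (ln x) / ln x)"
    using err unfolding w_def l_def by linarith
qed

lemma beta_Suc_bounds:
  assumes x: "x > exp 1" and b: "beta 0 x \<le> beta n x" "beta n x < Lambert_W0 x"
  shows "beta 0 x < beta (Suc n) x" "beta (Suc n) x < Lambert_W0 x"
    and "Lambert_W0 x - beta (Suc n) x < (Lambert_W0 x - beta n x)\<^sup>2 / beta 0 x"
proof -
  note b0 = beta_0_bounds(1)[OF x]
  have "beta n x > 0"
    using b0 b(1) by linarith
  moreover have "x > 0"
    using x exp_gt_zero[of "1::real"] by linarith
  ultimately have eq: "beta (Suc n) x = beta n x / (1 + beta n x) * (1 + (ln x - ln (beta n x)))"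
    by (simp add: ln_div)
  note step = beta_step[OF \<open>beta n x > 0\<close> b(2) Lambert_W0_gt_1(2)[OF x], folded eq]
  show "beta 0 x < beta (Suc n) x" "beta (Suc n) x < Lambert_W0 x"
    using step(1,2) b(1) by linarith+
  \<comment> \<open>The varying denominator is traded for the fixed \<open>beta 0 x\<close>. The
    trade is strict, which makes the final estimates strict.\<close>
  have "beta 0 x * 1 < beta n x * (1 + beta n x)"
    using b0 b(1) by (intro mult_le_less_imp_less) auto
  hence "(Lambert_W0 x - beta n x)\<^sup>2 / (beta n x * (1 + beta n x))
           < (Lambert_W0 x - beta n x)\<^sup>2 / beta 0 x"
    using b0 b by (intro divide_strict_left_mono mult_pos_pos) auto
  thus "Lambert_W0 x - beta (Suc n) x < (Lambert_W0 x - beta n x)\<^sup>2 / beta 0 x"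
    using step(3) by linarith
qed

lemma beta_bounds:
  assumes "x > exp 1"
  shows "beta 0 x \<le> beta n x \<and> beta n x < Lambert_W0 x"
proof (induction n)
  case 0
  show ?case
    using beta_0_bounds(2)[OF assms] by blast
next
  case (Suc n)
  thus ?case
    using beta_Suc_bounds(1,2)[OF assms, of n] by (meson less_imp_le)
qed

text \<open>Iterates the squaring estimate from an initial bound \<open>A\<close>. The parameter
  \<open>c\<close> lets one induction serve both estimates. At index 0 the bound may be attained, so
  strictness is claimed only for successors.\<close>

lemma beta_error_le:
  assumes x: "x > exp 1" and c: "0 < c" "c \<le> beta 0 x" and A: "Lambert_W0 x - beta 0 x \<le> A"
  shows "Lambert_W0 x - beta n x \<le> A ^ 2 ^ n / c ^ (2 ^ n - 1)"
    and "Lambert_W0 x - beta (Suc n) x < A ^ 2 ^ Suc n / c ^ (2 ^ Suc n - 1)"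
proof -
  have step: "Lambert_W0 x - beta (Suc m) x < A ^ 2 ^ Suc m / c ^ (2 ^ Suc m - 1)"
    if IH: "Lambert_W0 x - beta m x \<le> A ^ 2 ^ m / c ^ (2 ^ m - 1)" for m
  proof -
    have b: "beta 0 x \<le> beta m x" "beta m x < Lambert_W0 x"
      using beta_bounds[OF x, of m] by auto
    \<comment> \<open>Squaring doubles the exponent of \<open>c\<close> and the step adds one;
      truncated subtraction requires \<open>1 \<le> 2 ^ m\<close>.\<close>
    have exponent: "(2::nat) ^ Suc m - 1 = Suc ((2 ^ m - 1) * 2)"
      using one_le_power[of "2::nat" m] by (simp only: power_Suc) linarith
    have "Lambert_W0 x - beta (Suc m) x < (Lambert_W0 x - beta m x)\<^sup>2 / beta 0 x"
      by (rule beta_Suc_bounds(3)[OF x b])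
    also have "\<dots> \<le> (A ^ 2 ^ m / c ^ (2 ^ m - 1))\<^sup>2 / c"
      using IH b(2) c by (intro frac_le power_mono) auto
    also have "\<dots> = A ^ 2 ^ Suc m / c ^ (2 ^ Suc m - 1)"
      unfolding exponent
      by (simp add: power_divide mult.commute flip: power_mult)
    finally show ?thesis .
  qed
  show *: "Lambert_W0 x - beta n x \<le> A ^ 2 ^ n / c ^ (2 ^ n - 1)"
  proof (induction n)
    case 0
    show ?case
      using A by simp
  next
    case (Suc n)
    show ?case
      by (rule less_imp_le[OF step[OF Suc]])
  qed
  show "Lambert_W0 x - beta (Suc n) x < A ^ 2 ^ Suc n / c ^ (2 ^ Suc n - 1)"
    by (rule step[OF *])
qed

theorem theorem4p4:
  fixes n :: nat and x :: real
  assumes "n \<ge> 1" and "x > exp 1"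
  shows "0 < Lambert_W0 x - beta n x \<and>
         Lambert_W0 x - beta n x <
           (exp 1 / (exp 1 - 1) * (ln (ln x) / ln x)) ^ (2 ^ n) /
           (ln x - ln (ln x)) ^ (2 ^ n - 1) \<and>
         Lambert_W0 x - beta n x < kappa1 ^ (2 ^ n) \<and>
         kappa1 ^ (2 ^ n) < (32 / 100) ^ (2 ^ n)"
proof -
  obtain m where n: "n = Suc m"
    using assms(1) by (cases n) auto
  note b0 = beta_0_bounds[OF assms(2)]
  have "0 < Lambert_W0 x - beta n x"
    using beta_bounds[OF assms(2), of n] by simp
  moreover have "Lambert_W0 x - beta n x <
           (exp 1 / (exp 1 - 1) * (ln (ln x) / ln x)) ^ (2 ^ n) /
           (beta 0 x) ^ (2 ^ n - 1)"
    unfolding n using b0 by (intro beta_error_le(2) assms) auto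
  \<comment> \<open>The choice \<open>c = 1\<close>, allowed by \<open>1 < beta 0 x\<close>, makes
    the denominator trivial and the bound uniform in \<open>x\<close>.\<close>
  moreover have "Lambert_W0 x - beta n x < kappa1 ^ (2 ^ n) / 1 ^ (2 ^ n - 1)"
    unfolding n using b0 by (intro beta_error_le(2) assms) auto
  moreover have "kappa1 ^ (2 ^ n) < (32 / 100) ^ (2 ^ n)"
    using kappa1_pos kappa1_less by (intro power_strict_mono) auto
  ultimately show ?thesis
    by simp
qed

end
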